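(* For each adaptive deterministic algorithm $\mathcal{A}$ that finds a minimum-weight spanning forest, and each possible number of edges $m$, there is a graph $G_\mathcal{A}$ with $m$ edges and positive edge weights such that $\mathcal{A}$ terminates only after $\Omega(m)$ steps when given $G_\mathcal{A}$ as input.
   Context: Model: the input is a simple graph on vertex set $\{1,\dots,n\}$ with $m$ edges, each edge carrying a positive weight. Each of $m$ stations (with distinct IDs) holds exactly one edge with its weight, and each edge is held by one station. Computation is synchronous; in each step each station broadcasts a message or not; if exactly one station broadcasts its message is heard by all, if none silence is heard, if two or more a collision signal distinct from silence is heard. An edge is revealed when it is heard on the channel; the algorithm finds a minimum-weight spanning forest if all edges of some maximal acyclic subgraph of minimum total weight are revealed before it terminates. A deterministic adaptive algorithm: each station's action at each step is a deterministic function of $n$, its ID, its edge and weight, and the channel feedback heard in earlier steps. *)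

theory Defs
  imports Complex_Main
begin

section \<open>Forests in simple graphs\<close>

text \<open>An undirected edge is a two-element set of vertices; a graph is identified with its edge set.\<close>

type_synonym edge = "nat set"

definition simple_graph :: "nat \<Rightarrow> edge set \<Rightarrow> bool" where
  "simple_graph n E \<longleftrightarrow> (\<forall>e\<in>E. e \<subseteq> {1..n} \<and> card e = 2)"

definition is_cycle :: "edge set \<Rightarrow> nat list \<Rightarrow> bool" where
  "is_cycle E vs \<longleftrightarrow> 3 \<le> length vs \<and> distinct vs \<and>
     (\<forall>i<length vs. {vs ! i, vs ! (Suc i mod length vs)} \<in> E)"

definition acyclic_graph :: "edge set \<Rightarrow> bool" where
  "acyclic_graph F \<longleftrightarrow> (\<nexists>vs. is_cycle F vs)"

definition spanning_forest :: "edge set \<Rightarrow> edge set \<Rightarrow> bool" where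
  "spanning_forest E F \<longleftrightarrow> F \<subseteq> E \<and> acyclic_graph F \<and>
     (\<forall>F'. F \<subseteq> F' \<and> F' \<subseteq> E \<and> acyclic_graph F' \<longrightarrow> F' = F)"

definition min_spanning_forest :: "edge set \<Rightarrow> (edge \<Rightarrow> real) \<Rightarrow> edge set \<Rightarrow> bool" where
  "min_spanning_forest E w F \<longleftrightarrow> spanning_forest E F \<and>
     (\<forall>F'. spanning_forest E F' \<longrightarrow> sum w F \<le> sum w F')"

section \<open>Inputs\<close>

text \<open>Stations are identified with their IDs; \<open>held G s\<close> is the edge held by station \<open>s\<close>.\<close>

record input =
  num_vertices :: nat
  edges :: "edge set"
  weight :: "edge \<Rightarrow> real"
  stations :: "nat set"
  held :: "nat \<Rightarrow> edge"

definition valid_input :: "input \<Rightarrow> bool" where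
  "valid_input G \<longleftrightarrow> simple_graph (num_vertices G) (edges G) \<and>
     (\<forall>e\<in>edges G. 0 < weight G e) \<and>
     bij_betw (held G) (stations G) (edges G)"

section \<open>Algorithms on a multiple-access channel\<close>

text \<open>
  A message has an arbitrary payload of type \<open>'p\<close>, and may in addition carry the sender's own
  edge together with its weight. Only the latter reveals an edge: otherwise a station could
  reveal edges it does not know by blindly listing all pairs of vertices.
\<close>

datatype 'p message = Message (carried: "(edge \<times> real) option") (payload: 'p)

datatype 'p feedback = Silence | Collision | Heard "'p message"

text \<open>The flag of \<open>Broadcast\<close> says whether the station's own edge and weight are put in the message.\<close>

datatype 'p action = Listen | Broadcast bool 'p | Halt

text \<open>
  An algorithm determines the action of a station from the number of vertices, the ID of the
  station, its edge, the weight of this edge, and the feedback of the earlier steps (oldest first).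
\<close>

type_synonym 'p algorithm =
  "nat \<Rightarrow> nat \<Rightarrow> edge \<Rightarrow> real \<Rightarrow> 'p feedback list \<Rightarrow> 'p action"

definition station_action :: "'p algorithm \<Rightarrow> input \<Rightarrow> nat \<Rightarrow> 'p feedback list \<Rightarrow> 'p action" where
  "station_action A G s h = A (num_vertices G) s (held G s) (weight G (held G s)) h"

text \<open>Halting is irrevocable: a station that halted at an earlier point of \<open>h\<close> remains halted.\<close>

definition halted :: "'p algorithm \<Rightarrow> input \<Rightarrow> nat \<Rightarrow> 'p feedback list \<Rightarrow> bool" where
  "halted A G s h \<longleftrightarrow> (\<exists>k\<le>length h. station_action A G s (take k h) = Halt)"

definition sent :: "'p algorithm \<Rightarrow> input \<Rightarrow> nat \<Rightarrow> 'p feedback list \<Rightarrow> 'p message option" where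
  "sent A G s h =
     (if halted A G s h then None
      else case station_action A G s h of
        Broadcast b p \<Rightarrow>
          Some (Message (if b then Some (held G s, weight G (held G s)) else None) p)
      | _ \<Rightarrow> None)"

definition channel :: "'p algorithm \<Rightarrow> input \<Rightarrow> 'p feedback list \<Rightarrow> 'p feedback" where
  "channel A G h =
     (let B = {s \<in> stations G. sent A G s h \<noteq> None} in
      if B = {} then Silence
      else if card B = 1 then Heard (the (sent A G (the_elem B) h))
      else Collision)"

primrec history :: "'p algorithm \<Rightarrow> input \<Rightarrow> nat \<Rightarrow> 'p feedback list" where
  "history A G 0 = []"
| "history A G (Suc t) = history A G t @ [channel A G (history A G t)]"

definition revealed :: "'p feedback list \<Rightarrow> edge set" where
  "revealed h = {e. \<exists>w p. Heard (Message (Some (e, w)) p) \<in> set h}"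

definition terminated :: "'p algorithm \<Rightarrow> input \<Rightarrow> nat \<Rightarrow> bool" where
  "terminated A G t \<longleftrightarrow> (\<forall>s\<in>stations G. halted A G s (history A G t))"

definition termination_time :: "'p algorithm \<Rightarrow> input \<Rightarrow> nat" where
  "termination_time A G = (LEAST t. terminated A G t)"

definition finds_min_spanning_forest :: "'p algorithm \<Rightarrow> bool" where
  "finds_min_spanning_forest A \<longleftrightarrow>
     (\<forall>G. valid_input G \<longrightarrow>
        (\<exists>t. terminated A G t) \<and>
        (\<exists>F. min_spanning_forest (edges G) (weight G) F \<and>
             F \<subseteq> revealed (history A G (termination_time A G))))"

end

theory Submission
  imports Defs
begin

text \<open>
  The bound holds with constant 1 and for every graph with \<open>m\<close> edges: an adversary fixes the graph
  and keeps, for each station not heard so far, an infinite set of candidate weights \<open>1 / (k + 1)\<close>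
  on which the decisions of the station to broadcast do not depend on the weight. In each
  step these sets are thinned out (an infinite set split in two has an infinite part); a station
  that is heard gets a fixed weight. After \<open>m - 1\<close> steps some station has not been heard, and its
  weight can still be made strictly smaller than all the others, so its edge lies in every
  minimum-weight spanning forest without being revealed.
\<close>

section \<open>Spanning forests\<close>

definition adjacency :: "edge set \<Rightarrow> (nat \<times> nat) set" where
  "adjacency F = {(x, y). {x, y} \<in> F}"

lemma sym_adjacency: "sym (adjacency F)"
  by (auto simp: adjacency_def sym_def insert_commute)

lemma acyclic_graph_mono: "acyclic_graph F \<Longrightarrow> F' \<subseteq> F \<Longrightarrow> acyclic_graph F'"
  unfolding acyclic_graph_def is_cycle_def by blast

text \<open>A cycle runs through each of its edges only once: otherwise two positions would be
  successors of each other, which forces length 2.\<close>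

lemma cycle_edge_inj:
  assumes "3 \<le> length vs" "distinct vs" "i < length vs" "j < length vs"
    and eq: "{vs ! i, vs ! (Suc i mod length vs)} = {vs ! j, vs ! (Suc j mod length vs)}"
  shows "i = j"
proof (rule ccontr)
  assume "i \<noteq> j"
  have l: "Suc i mod length vs < length vs" "Suc j mod length vs < length vs"
    using assms(1) by (auto intro!: mod_less_divisor)
  have "i = Suc j mod length vs" "j = Suc i mod length vs"
    using eq \<open>i \<noteq> j\<close> assms l by (auto simp: doubleton_eq_iff nth_eq_iff_index_eq)
  moreover have "Suc k mod length vs = (if Suc k = length vs then 0 else Suc k)"
    if "k < length vs" for k
    using that by auto
  ultimately show False
    using assms(1,3,4) by (auto split: if_splits)
qed

lemma acyclic_graph_singleton: "acyclic_graph {e}"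
  unfolding acyclic_graph_def
proof
  assume "\<exists>vs. is_cycle {e} vs"
  then obtain vs where vs: "is_cycle {e} vs" by blast
  then have vs': "3 \<le> length vs" "distinct vs"
    "\<And>i. i < length vs \<Longrightarrow> {vs ! i, vs ! (Suc i mod length vs)} = e"
    by (simp_all add: is_cycle_def)
  then have "0 < length vs" "1 < length vs" by linarith+
  then have "0 = (1::nat)"
    using cycle_edge_inj[OF vs'(1,2)] vs'(3) by blast
  then show False by simp
qed

text \<open>A cycle that appears with \<open>{a, b}\<close> uses this edge exactly once, so the rest
  of it is a path in \<open>F\<close> between the two ends.\<close>

lemma cycle_closing_edge_connected:
  assumes "acyclic_graph F" "\<not> acyclic_graph (insert {a, b} F)"
  shows "(a, b) \<in> (adjacency F)\<^sup>*"
proof -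
  obtain vs where vs: "is_cycle (insert {a, b} F) vs" and "\<not> is_cycle F vs"
    using assms by (auto simp: acyclic_graph_def)
  define l where "l = length vs"
  have l: "3 \<le> l" "distinct vs" and
    E: "\<And>i. i < l \<Longrightarrow> {vs ! i, vs ! (Suc i mod l)} \<in> insert {a, b} F"
    using vs by (auto simp: is_cycle_def l_def)
  obtain i where i: "i < l" "{vs ! i, vs ! (Suc i mod l)} \<notin> F"
    using \<open>\<not> is_cycle F vs\<close> l by (auto simp: is_cycle_def l_def)
  then have ab: "{vs ! i, vs ! (Suc i mod l)} = {a, b}"
    using E by blast
  have F: "{vs ! j, vs ! (Suc j mod l)} \<in> F" if "j < l" "j \<noteq> i" for j
    using E[OF that(1)] ab cycle_edge_inj[of vs j i] that l i unfolding l_def by auto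
  have "(vs ! (Suc i mod l), vs ! ((Suc i + k) mod l)) \<in> (adjacency F)\<^sup>*" if "k < l" for k
    using that
  proof (induction k)
    case (Suc k)
    \<comment> \<open>The walk starts just behind the missing edge at position \<open>i\<close> and
      is back at \<open>i\<close> only for \<open>k = l - 1\<close>, so no step before that uses
      this edge.\<close>
    have "(Suc i + k) mod l \<noteq> i"
    proof
      assume "(Suc i + k) mod l = i"
      then have "Suc i + k = i \<or> Suc i + k = i + l"
        using i Suc.prems by (auto simp: mod_if split: if_splits)
      then show False using Suc.prems by linarith
    qed
    moreover have "(Suc i + k) mod l < l" using l by (intro mod_less_divisor) simp
    ultimately have "{vs ! ((Suc i + k) mod l), vs ! ((Suc i + Suc k) mod l)} \<in> F"
      using F[of "(Suc i + k) mod l"] by (simp add: mod_Suc_eq)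
    then show ?case
      using Suc by (auto simp: adjacency_def intro: rtrancl_into_rtrancl)
  qed simp
  from this[of "l - 1"] have "(vs ! (Suc i mod l), vs ! i) \<in> (adjacency F)\<^sup>*"
    using i l by simp
  with ab show ?thesis
    using sym_rtrancl[OF sym_adjacency, of F] by (auto simp: doubleton_eq_iff dest: symD)
qed

text \<open>Distinctness survives each extension: if the new vertex already lies on the path, the
  path is cut off at that vertex instead.\<close>

lemma connected_simple_path:
  assumes "(a, b) \<in> (adjacency F)\<^sup>*"
  shows "\<exists>vs. vs \<noteq> [] \<and> distinct vs \<and> hd vs = a \<and> last vs = b \<and>
    (\<forall>i. Suc i < length vs \<longrightarrow> {vs ! i, vs ! Suc i} \<in> F)"
  using assms
proof (induction rule: rtrancl_induct)
  case base
  then show ?case by (intro exI[of _ "[a]"]) simp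
next
  case (step y z)
  then obtain vs where vs: "vs \<noteq> []" "distinct vs" "hd vs = a" "last vs = y"
    "\<And>i. Suc i < length vs \<Longrightarrow> {vs ! i, vs ! Suc i} \<in> F" by blast
  show ?case
  proof (cases "z \<in> set vs")
    case True
    then obtain k where k: "k < length vs" "vs ! k = z" by (auto simp: in_set_conv_nth)
    then have "last (take (Suc k) vs) = z" by (simp add: take_Suc_conv_app_nth)
    with vs k show ?thesis
      by (intro exI[of _ "take (Suc k) vs"]) auto
  next
    case False
    have "{(vs @ [z]) ! i, (vs @ [z]) ! Suc i} \<in> F" if "Suc i < length (vs @ [z])" for i
    proof (cases "Suc i < length vs")
      case False
      then have "i = length vs - 1" using that by simp
      then show ?thesis
        using vs step.hyps(2) by (simp add: adjacency_def nth_append last_conv_nth)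
    qed (use vs in \<open>simp add: nth_append\<close>)
    with False vs show ?thesis
      by (intro exI[of _ "vs @ [z]"]) auto
  qed
qed

lemma connected_edge_closes_cycle:
  assumes "(a, b) \<in> (adjacency F)\<^sup>*" "a \<noteq> b" "{a, b} \<notin> F"
  shows "\<not> acyclic_graph (insert {a, b} F)"
proof -
  obtain vs where vs: "vs \<noteq> []" "distinct vs" "hd vs = a" "last vs = b"
    "\<And>i. Suc i < length vs \<Longrightarrow> {vs ! i, vs ! Suc i} \<in> F"
    using connected_simple_path[OF assms(1)] by blast
  have ab: "vs ! 0 = a" "vs ! (length vs - 1) = b"
    using vs by (auto simp: hd_conv_nth last_conv_nth)
  \<comment> \<open>Length 1 would mean \<open>a = b\<close>, and length 2 would put
    \<open>{a, b}\<close> into \<open>F\<close>.\<close>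
  have "length vs \<noteq> 0" "length vs \<noteq> 1" "length vs \<noteq> 2"
    using vs(1) vs(5)[of 0] ab assms by auto
  then have "3 \<le> length vs" by linarith
  moreover have "{vs ! i, vs ! (Suc i mod length vs)} \<in> insert {a, b} F" if "i < length vs" for i
  proof (cases "Suc i < length vs")
    case False
    then have "Suc i = length vs" "i = length vs - 1" using that by auto
    then show ?thesis using ab by (auto simp: insert_commute)
  qed (use vs in simp)
  ultimately show ?thesis
    using vs(2) by (auto simp: acyclic_graph_def is_cycle_def)
qed

section \<open>Maximality of a forest as connectivity\<close>

lemma spanning_forest_connects:
  assumes "spanning_forest E F" "{a, b} \<in> E"
  shows "(a, b) \<in> (adjacency F)\<^sup>*"
proof (cases "{a, b} \<in> F")
  case False
  have F: "F \<subseteq> E" "acyclic_graph F"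
    and max: "\<And>F'. F \<subseteq> F' \<Longrightarrow> F' \<subseteq> E \<Longrightarrow> acyclic_graph F' \<Longrightarrow> F' = F"
    using assms(1) by (auto simp: spanning_forest_def)
  have "\<not> acyclic_graph (insert {a, b} F)"
    using max[of "insert {a, b} F"] F(1) assms(2) False by auto
  with F(2) show ?thesis by (rule cycle_closing_edge_connected)
qed (auto simp: adjacency_def)

text \<open>Any further edge would join two connected vertices and close a cycle. Cardinality 2
  matters: a one-vertex edge never lies on a cycle.\<close>

lemma connecting_forest_spans:
  assumes "F \<subseteq> E" "acyclic_graph F"
    and "\<And>e. e \<in> E \<Longrightarrow> card e = 2"
    and "\<And>a b. {a, b} \<in> E \<Longrightarrow> (a, b) \<in> (adjacency F)\<^sup>*"
  shows "spanning_forest E F"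
  unfolding spanning_forest_def
proof (intro conjI allI impI assms(1,2))
  fix F' assume F': "F \<subseteq> F' \<and> F' \<subseteq> E \<and> acyclic_graph F'"
  have "g \<in> F" if "g \<in> F'" for g
  proof (rule ccontr)
    assume "g \<notin> F"
    have "g \<in> E" using that F' by blast
    then obtain c d where "g = {c, d}" "c \<noteq> d" using assms(3) by (meson card_2_iff)
    then have "\<not> acyclic_graph (insert g F)"
      using connected_edge_closes_cycle assms(4) \<open>g \<in> E\<close> \<open>g \<notin> F\<close> by blast
    moreover have "insert g F \<subseteq> F'" using F' that by blast
    ultimately show False using F' acyclic_graph_mono by blast
  qed
  with F' show "F' = F" by blast
qed

text \<open>
  A maximal acyclic subset of \<open>insert e F\<close> that contains \<open>e\<close> still spans, and it omits
  an edge of \<open>F\<close>; this exchange needs no uniqueness of cycles.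
\<close>

lemma strict_min_edge_in_min_spanning_forest:
  assumes "finite E" and two: "\<And>e. e \<in> E \<Longrightarrow> card e = 2"
    and pos: "\<And>e. e \<in> E \<Longrightarrow> 0 < w e"
    and msf: "min_spanning_forest E w F"
    and "e \<in> E" and min: "\<And>e'. e' \<in> E \<Longrightarrow> e' \<noteq> e \<Longrightarrow> w e < w e'"
  shows "e \<in> F"
proof (rule ccontr)
  assume "e \<notin> F"
  have sf: "spanning_forest E F" and "F \<subseteq> E" "acyclic_graph F"
    using msf by (auto simp: min_spanning_forest_def spanning_forest_def)
  then have "finite F" using \<open>finite E\<close> finite_subset by blast
  define X where "X = {F'. {e} \<subseteq> F' \<and> F' \<subseteq> insert e F \<and> acyclic_graph F'}"
  have "finite X"
    using \<open>finite F\<close> by (intro finite_subset[of X "Pow (insert e F)"]) (auto simp: X_def)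
  moreover have "{e} \<in> X" by (simp add: X_def acyclic_graph_singleton)
  ultimately have "\<exists>F1\<in>X. {e} \<subseteq> F1 \<and> (\<forall>F'\<in>X. F1 \<subseteq> F' \<longrightarrow> F1 = F')"
    by (rule finite_has_maximal2)
  then obtain F1 where "F1 \<in> X" and max: "\<And>F'. F' \<in> X \<Longrightarrow> F1 \<subseteq> F' \<Longrightarrow> F1 = F'"
    by auto
  then have F1: "e \<in> F1" "F1 \<subseteq> insert e F" "acyclic_graph F1" by (auto simp: X_def)
  have sf1: "spanning_forest (insert e F) F1"
    unfolding spanning_forest_def
  proof (intro conjI allI impI F1)
    fix F' assume "F1 \<subseteq> F' \<and> F' \<subseteq> insert e F \<and> acyclic_graph F'"
    then show "F' = F1" using F1 max[of F'] by (auto simp: X_def)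
  qed
  \<comment> \<open>Each edge of \<open>F\<close> lies in \<open>insert e F\<close>, where
    \<open>F1\<close> spans; so \<open>F1\<close> connects whatever \<open>F\<close> connects, in
    particular the ends of every edge of \<open>E\<close>.\<close>
  have "adjacency F \<subseteq> (adjacency F1)\<^sup>*"
    using spanning_forest_connects[OF sf1] by (auto simp: adjacency_def)
  then have "(adjacency F)\<^sup>* \<subseteq> (adjacency F1)\<^sup>*"
    by (metis rtrancl_mono rtrancl_idemp)
  then have "spanning_forest E F1"
    using F1 \<open>F \<subseteq> E\<close> \<open>e \<in> E\<close> two spanning_forest_connects[OF sf]
    by (intro connecting_forest_spans) blast+
  then have le: "sum w F \<le> sum w F1" using msf by (auto simp: min_spanning_forest_def)
  have "F1 \<noteq> insert e F"
    using sf F1 \<open>e \<notin> F\<close> \<open>e \<in> E\<close> \<open>F \<subseteq> E\<close> unfolding spanning_forest_def by blast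
  then obtain g where g: "g \<in> F" "g \<notin> F1" using F1 by blast
  have "sum w F1 = w e + sum w (F1 - {e})"
    using F1 \<open>finite F\<close> by (intro sum.remove) (auto intro: finite_subset)
  moreover have "w e < w g" using g F1 \<open>F \<subseteq> E\<close> by (intro min) auto
  \<comment> \<open>Only an inclusion of the two sets is at hand; positive weights cover any further
    edges that \<open>F1\<close> omits.\<close>
  moreover have "sum w (F1 - {e}) \<le> sum w (F - {g})"
  proof (rule sum_mono2)
    show "0 \<le> w b" if "b \<in> F - {g} - (F1 - {e})" for b
      using that \<open>F \<subseteq> E\<close> pos[of b] by auto
  qed (use F1 g \<open>finite F\<close> in auto)
  moreover have "sum w F = w g + sum w (F - {g})"
    using g \<open>finite F\<close> by (simp add: sum.remove)
  ultimately show False using le by linarith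
qed

section \<open>The adversary\<close>

text \<open>Only \<open>x\<close> varies. Weights belong to edges, so \<open>inv_into\<close>
  recovers the holder; a larger index gives a lighter edge, so an infinite candidate set has no
  lightest member.\<close>

definition adversary_input :: "nat \<Rightarrow> nat set \<Rightarrow> (nat \<Rightarrow> edge) \<Rightarrow> (nat \<Rightarrow> nat) \<Rightarrow> input" where
  "adversary_input n S f x =
     \<lparr>num_vertices = n, edges = f ` S,
      weight = (\<lambda>e. 1 / real (Suc (x (inv_into S f e)))), stations = S, held = f\<rparr>"

lemma adversary_input_simps [simp]:
  "num_vertices (adversary_input n S f x) = n"
  "edges (adversary_input n S f x) = f ` S"
  "stations (adversary_input n S f x) = S"
  "held (adversary_input n S f x) = f"
  by (simp_all add: adversary_input_def)

lemma weight_adversary_input: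
  "inj_on f S \<Longrightarrow> s \<in> S \<Longrightarrow> weight (adversary_input n S f x) (f s) = 1 / real (Suc (x s))"
  by (simp add: adversary_input_def)

lemma valid_adversary_input:
  "inj_on f S \<Longrightarrow> simple_graph n (f ` S) \<Longrightarrow> valid_input (adversary_input n S f x)"
  by (auto simp: valid_input_def weight_adversary_input inj_on_imp_bij_betw)

text \<open>A station sees only its own weight, so the indices of the others may be replaced at
  will.\<close>

lemma sent_adversary_input:
  assumes "inj_on f S" "s \<in> S"
  shows "sent A (adversary_input n S f x) s h = sent A (adversary_input n S f (\<lambda>_. x s)) s h"
  using assms by (simp add: sent_def halted_def station_action_def weight_adversary_input split: action.split)

lemma sent_carries_held:
  "sent A G s h = Some (Message (Some (e, w)) p) \<Longrightarrow> e = held G s"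
  by (auto simp: sent_def split: if_splits action.splits)

lemma revealed_append: "revealed (h @ h') = revealed h \<union> revealed h'"
  by (auto simp: revealed_def)

lemma revealed_history_mono: "t \<le> t' \<Longrightarrow> revealed (history A G t) \<subseteq> revealed (history A G t')"
  by (induction t' rule: dec_induct) (auto simp: revealed_append)

lemma infinite_decided_subset:
  assumes "infinite (U :: nat set)"
  obtains V where "V \<subseteq> U" "infinite V" "(\<forall>k\<in>V. P k) \<or> (\<forall>k\<in>V. \<not> P k)"
proof -
  have "U = {k\<in>U. P k} \<union> {k\<in>U. \<not> P k}" by blast
  then have "infinite {k\<in>U. P k} \<or> infinite {k\<in>U. \<not> P k}"
    using assms by (metis finite_UnI)
  then show ?thesis
    using that[of "{k\<in>U. P k}"] that[of "{k\<in>U. \<not> P k}"] by blast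
qed

text \<open>\<open>K\<close> contains the stations heard in the first \<open>t\<close> steps, \<open>U s\<close> the candidates for \<open>x s\<close>.\<close>

definition undetermined ::
    "'p algorithm \<Rightarrow> nat \<Rightarrow> nat set \<Rightarrow> (nat \<Rightarrow> edge) \<Rightarrow> nat \<Rightarrow>
     'p feedback list \<Rightarrow> nat set \<Rightarrow> (nat \<Rightarrow> nat set) \<Rightarrow> bool" where
  "undetermined A n S f t h K U \<longleftrightarrow>
     finite K \<and> card K \<le> t \<and> K \<subseteq> S \<and> revealed h \<subseteq> f ` K \<and>
     (\<forall>s\<in>K. \<exists>a. U s = {a}) \<and> (\<forall>s\<in>S - K. infinite (U s)) \<and>
     (\<forall>x. (\<forall>s\<in>S. x s \<in> U s) \<longrightarrow> history A (adversary_input n S f x) t = h)"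

text \<open>Contents of messages matter only when a single station sends; it suffices to decide who
  sends, and to fix the weight of a lone sender.\<close>

lemma adversary_strategy:
  fixes A :: "'p algorithm"
  assumes inj: "inj_on f S"
  shows "\<exists>h K U. undetermined A n S f t h K U"
proof (induction t)
  case 0
  have "undetermined A n S f 0 [] {} (\<lambda>_. UNIV)"
    by (simp add: undetermined_def revealed_def)
  then show ?case by blast
next
  case (Suc t)
  then obtain h K U where "undetermined A n S f t h K U" by blast
  then have K: "finite K" "card K \<le> t" "K \<subseteq> S" "revealed h \<subseteq> f ` K"
    and U: "\<And>s. s \<in> K \<Longrightarrow> \<exists>a. U s = {a}" "\<And>s. s \<in> S - K \<Longrightarrow> infinite (U s)"
    and h: "\<And>x. (\<forall>s\<in>S. x s \<in> U s) \<Longrightarrow> history A (adversary_input n S f x) t = h"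
    by (simp_all add: undetermined_def)
  define msg where "msg s k = sent A (adversary_input n S f (\<lambda>_. k)) s h" for s k
  \<comment> \<open>Only whether \<open>s\<close> sends becomes constant on \<open>V\<close>; the
    message itself may still vary with the weight.\<close>
  define thinned where "thinned s V \<longleftrightarrow> V \<subseteq> U s \<and> (s \<in> K \<longrightarrow> V = U s) \<and>
      (s \<in> S - K \<longrightarrow> infinite V) \<and>
      ((\<forall>k\<in>V. msg s k \<noteq> None) \<or> (\<forall>k\<in>V. \<not> msg s k \<noteq> None))" for s V
  have "\<forall>s\<in>S. \<exists>V. thinned s V"
  proof
    fix s assume "s \<in> S"
    show "\<exists>V. thinned s V"
    proof (cases "s \<in> K")
      case True
      then have "thinned s (U s)" using U(1)[of s] by (auto simp: thinned_def)
      then show ?thesis by blast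
    next
      case False
      then have "infinite (U s)" using U(2) \<open>s \<in> S\<close> by simp
      then obtain V where "V \<subseteq> U s" "infinite V"
        "(\<forall>k\<in>V. msg s k \<noteq> None) \<or> (\<forall>k\<in>V. \<not> msg s k \<noteq> None)"
        by (rule infinite_decided_subset)
      then show ?thesis using False by (intro exI[of _ V]) (simp add: thinned_def)
    qed
  qed
  from bchoice[OF this] obtain V where "\<forall>s\<in>S. thinned s (V s)" ..
  then have V: "\<And>s. s \<in> S \<Longrightarrow> V s \<subseteq> U s" "\<And>s. s \<in> K \<Longrightarrow> V s = U s"
      "\<And>s. s \<in> S - K \<Longrightarrow> infinite (V s)"
      "\<And>s. s \<in> S \<Longrightarrow> (\<forall>k\<in>V s. msg s k \<noteq> None) \<or> (\<forall>k\<in>V s. msg s k = None)"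
    using K(3) by (simp_all add: thinned_def subset_iff)
  \<comment> \<open>After thinning, \<open>B\<close> is the set of senders for every admissible
    \<open>x\<close> at once.\<close>
  define B where "B = {s\<in>S. \<forall>k\<in>V s. msg s k \<noteq> None}"
  have channel: "channel A (adversary_input n S f x) h =
      (if B = {} then Silence
       else if card B = 1 then Heard (the (msg (the_elem B) (x (the_elem B)))) else Collision)"
    if x: "\<forall>s\<in>S. x s \<in> V s" for x
  proof -
    have sent: "sent A (adversary_input n S f x) s h = msg s (x s)" if "s \<in> S" for s
      using sent_adversary_input[OF inj that] by (simp add: msg_def)
    have B: "{s\<in>S. sent A (adversary_input n S f x) s h \<noteq> None} = B"
      unfolding B_def
    proof (intro Collect_cong conj_cong refl)
      fix s assume s: "s \<in> S"
      then have "x s \<in> V s" using x by blast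
      then show "sent A (adversary_input n S f x) s h \<noteq> None \<longleftrightarrow> (\<forall>k\<in>V s. msg s k \<noteq> None)"
        using V(4)[OF s] sent[OF s] by metis
    qed
    have "the_elem B \<in> S" if "card B = 1"
      using that by (auto simp: B_def card_1_singleton_iff)
    then show ?thesis
      unfolding channel_def Let_def adversary_input_simps B by (simp add: sent)
  qed
  have history: "history A (adversary_input n S f x) (Suc t) =
      h @ [channel A (adversary_input n S f x) h]" if "\<forall>s\<in>S. x s \<in> V s" for x
    using that V(1) h[of x] by auto
  show ?case
  proof (cases "card B = 1")
    case False
    define c :: "'p feedback" where "c = (if B = {} then Silence else Collision)"
    have "revealed [c] = {}" by (auto simp: revealed_def c_def)
    \<comment> \<open>Silence and collision carry no content, so no further weight has to be
      fixed.\<close>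
    with False K U V channel history have "undetermined A n S f (Suc t) (h @ [c]) K V"
      by (simp add: undetermined_def revealed_append c_def)
    then show ?thesis by blast
  next
    case True
    then obtain r where r: "B = {r}" by (auto simp: card_1_singleton_iff)
    have "r \<in> S" using r by (auto simp: B_def)
    then have "V r \<noteq> {}"
      using V(2)[of r] V(3)[of r] U(1)[of r] by (cases "r \<in> K") auto
    then obtain a where a: "a \<in> V r" by blast
    then have "msg r a \<noteq> None" using r by (auto simp: B_def)
    define c where "c = Heard (the (msg r a))"
    \<comment> \<open>A message can reveal only the edge of its sender.\<close>
    have "revealed [c] \<subseteq> {f r}"
      using \<open>msg r a \<noteq> None\<close> by (auto simp: revealed_def c_def msg_def dest!: sent_carries_held)
    have "history A (adversary_input n S f x) (Suc t) = h @ [c]"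
      if "\<forall>s\<in>S. x s \<in> (V(r := {a})) s" for x
    proof -
      have "x r = a" "\<forall>s\<in>S. x s \<in> V s" using that a \<open>r \<in> S\<close> by (auto split: if_splits)
      then show ?thesis using history channel r by (simp add: c_def)
    qed
    \<comment> \<open>\<open>r\<close> may have been heard before, in which case \<open>K\<close>
      does not grow.\<close>
    moreover have "card (insert r K) \<le> Suc t"
      using K(1,2) by (simp add: card_insert_if)
    moreover have "\<forall>s\<in>insert r K. \<exists>a'. (V(r := {a})) s = {a'}"
      using U(1) V(2) by auto
    moreover have "\<forall>s\<in>S - insert r K. infinite ((V(r := {a})) s)"
      using V(3) by auto
    moreover have "revealed (h @ [c]) \<subseteq> f ` insert r K"
      using K(4) \<open>revealed [c] \<subseteq> {f r}\<close> by (auto simp: revealed_append)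
    ultimately have "undetermined A n S f (Suc t) (h @ [c]) (insert r K) (V(r := {a}))"
      using K(1,3) \<open>r \<in> S\<close> unfolding undetermined_def by blast
    then show ?thesis by blast
  qed
qed

section \<open>The lower bound\<close>

lemma termination_time_lower_bound:
  fixes A :: "'p algorithm"
  assumes A: "finds_min_spanning_forest A" and "finite S" "inj_on f S" "simple_graph n (f ` S)"
  shows "\<exists>x. card S \<le> termination_time A (adversary_input n S f x)"
proof (cases "S = {}")
  case False
  obtain h K U where "undetermined A n S f (card S - 1) h K U"
    using adversary_strategy[OF assms(3)] by blast
  then have K: "finite K" "card K \<le> card S - 1" "K \<subseteq> S" "revealed h \<subseteq> f ` K"
    and U: "\<And>s. s \<in> K \<Longrightarrow> \<exists>a. U s = {a}" "\<And>s. s \<in> S - K \<Longrightarrow> infinite (U s)"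
    and h: "\<And>x. (\<forall>s\<in>S. x s \<in> U s) \<Longrightarrow> history A (adversary_input n S f x) (card S - 1) = h"
    by (simp_all add: undetermined_def)
  \<comment> \<open>Since \<open>S\<close> is nonempty, \<open>card S - 1\<close> is a true
    predecessor, and \<open>K\<close> misses a station.\<close>
  have "card S \<noteq> 0" using False \<open>finite S\<close> by simp
  then have "K \<noteq> S" using K(2) by auto
  then obtain s where s: "s \<in> S" "s \<notin> K" using K(3) by blast
  have "\<exists>a. a \<in> U r" if "r \<in> S" for r
    using U(1)[of r] U(2)[of r] that by (cases "r \<in> K") (auto intro: ccontr)
  then obtain y where y: "\<And>r. r \<in> S \<Longrightarrow> y r \<in> U r" by metis
  \<comment> \<open>An infinite set of naturals is unbounded, so the index of \<open>s\<close> can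
    exceed all others while staying a candidate: the history is still \<open>h\<close>, and
    \<open>f s\<close> is strictly lightest.\<close>
  obtain a where a: "a \<in> U s" "Max (y ` S) < a"
    using U(2)[of s] s by (auto simp: finite_nat_set_iff_bounded_le not_le)
  have less: "y r < a" if "r \<in> S" for r
    using that a(2) \<open>finite S\<close> by (meson Max_ge finite_imageI image_eqI le_less_trans)
  define G where "G = adversary_input n S f (y(s := a))"
  have hist: "history A G (card S - 1) = h"
    unfolding G_def using y a by (intro h) auto
  have valid: "valid_input G"
    unfolding G_def by (intro valid_adversary_input assms)
  then obtain F where F: "min_spanning_forest (edges G) (weight G) F"
    "F \<subseteq> revealed (history A G (termination_time A G))"
    using A by (auto simp: finds_min_spanning_forest_def)
  have "f s \<in> F"
  proof (rule strict_min_edge_in_min_spanning_forest[OF _ _ _ F(1)])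
    show "finite (edges G)" "f s \<in> edges G"
      using \<open>finite S\<close> s by (auto simp: G_def)
    show "card e = 2" "0 < weight G e" if "e \<in> edges G" for e
      using that valid by (auto simp: valid_input_def simple_graph_def)
    show "weight G (f s) < weight G e" if "e \<in> edges G" "e \<noteq> f s" for e
      using that less s assms(3)
      by (auto simp: G_def weight_adversary_input intro!: divide_strict_left_mono)
  qed
  moreover have "f s \<notin> revealed h"
    using K(3,4) s inj_on_image_mem_iff[OF assms(3) s(1) K(3)] by blast
  \<comment> \<open>Stopping within \<open>card S - 1\<close> steps would leave \<open>f s\<close>
    unrevealed, as the revealed set only grows with time.\<close>
  ultimately have "\<not> termination_time A G \<le> card S - 1"
    using F(2) hist revealed_history_mono[of "termination_time A G" "card S - 1" A G] by blast
  then show ?thesis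
    by (intro exI[of _ "y(s := a)"]) (simp add: G_def)
qed simp

text \<open>\<open>c\<close> is chosen before the algorithm, so the bound is uniform. The condition
  \<open>m \<le> n choose 2\<close> says that a simple graph with \<open>m\<close> edges exists on
  \<open>n\<close> vertices; the station IDs are prescribed arbitrarily.\<close>

theorem theorem5:
  "\<exists>c::real. 0 < c \<and>
     (\<forall>(A :: 'p algorithm) n m S.
        finds_min_spanning_forest A \<and> m \<le> n choose 2 \<and> finite S \<and> card S = m \<longrightarrow>
        (\<exists>G. valid_input G \<and> num_vertices G = n \<and> stations G = S \<and> card (edges G) = m \<and>
             c * real m \<le> real (termination_time A G)))"
proof (intro exI[of _ 1] conjI allI impI)
  fix A :: "'p algorithm" and n m and S :: "nat set"
  assume H: "finds_min_spanning_forest A \<and> m \<le> n choose 2 \<and> finite S \<and> card S = m"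
  have "card {e. e \<subseteq> {1..n} \<and> card e = 2} = n choose 2"
    using n_subsets[of "{1..n}" 2] by simp
  then have "m \<le> card {e. e \<subseteq> {1..n} \<and> card e = 2}"
    using H by simp
  then obtain E where E: "E \<subseteq> {e. e \<subseteq> {1..n} \<and> card e = 2}" "card E = m" "finite E"
    by (rule obtain_subset_with_card_n)
  then obtain f where f: "bij_betw f S E"
    using H finite_same_card_bij[of S E] by auto
  then have inj: "inj_on f S" and simple: "simple_graph n (f ` S)" and card: "card (f ` S) = m"
    using E by (auto simp: bij_betw_def simple_graph_def)
  obtain x where "m \<le> termination_time A (adversary_input n S f x)"
    using termination_time_lower_bound[of A S f n] H inj simple by blast
  then show "\<exists>G. valid_input G \<and> num_vertices G = n \<and> stations G = S \<and> card (edges G) = m \<and>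
      1 * real m \<le> real (termination_time A G)"
    using valid_adversary_input[OF inj simple] card
    by (intro exI[of _ "adversary_input n S f x"]) simp
qed simp

end
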